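(* For all integers $n\ge 0$ and all $x,t\in\mathbb{R}$ for which the series involved converge, with in addition $t\neq -1$ in the case of the second identity, $$\sum_{j\ge 0}\frac{t^{j}}{j!}H_{n+j}(x)=H_n(x-t)\sum_{j\ge 0}\frac{t^{j}}{j!}H_j(x),$$ $$\sum_{j\ge 0}\frac{t^{j}}{j!}\lambda_{n+j}(x,\alpha)=\frac{\lambda_n\!\left(\frac{x}{1+t},\alpha\right)}{(1+t)^{n}}\sum_{j\ge 0}\frac{t^{j}}{j!}\lambda_j(x,\alpha),$$ $$\sum_{j\ge 0}t^{j}U_{n+j}(x)=\bigl(U_n(x)-t\,U_{n-1}(x)\bigr)\sum_{j\ge 0}t^{j}U_j(x).$$
   Context: $\{H_n\}_{n\ge -1}$ are the classical Hermite polynomials: $H_{-1}(x)=0$, $H_0(x)=1$, $H_{n+1}(x)=2xH_n(x)-2nH_{n-1}(x)$. $\{\lambda_n(x,\alpha)\}_{n\ge -1}$ are the monic versions of the Laguerre polynomials, $\lambda_n(x,\alpha)=(-1)^n n!\,L_n^{(\alpha)}(x)$ for $n\ge 0$ (and $\lambda_{-1}=0$), where $L_n^{(\alpha)}$ are the traditional Laguerre polynomials with parameter $\alpha$: $L_{-1}^{(\alpha)}=0$, $L_0^{(\alpha)}=1$, $(n+1)L_{n+1}^{(\alpha)}(x)=(2n+\alpha+1-x)L_n^{(\alpha)}(x)-(n+\alpha)L_{n-1}^{(\alpha)}(x)$. $\{U_n\}_{n\ge -1}$ are the Chebyshev polynomials of the second kind: $U_{-1}(x)=0$, $U_0(x)=1$,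 $2xU_n(x)=U_{n+1}(x)+U_{n-1}(x)$ for $n\ge 0$. *)

theory Defs
  imports Complex_Main
begin

text \<open>
  All three families are indexed by the integers, so that the index \<open>-1\<close> is available;
  indices below \<open>-1\<close> play no role and get the value 0 as well. The recursion equations are
  the usual three-term recurrences with \<open>n\<close> replaced by \<open>n - 1\<close>; the usual forms are the
  lemmas that follow each definition.
\<close>

function hermite :: "int \<Rightarrow> real \<Rightarrow> real" where
  "hermite n x =
    (if n < 0 then 0
     else if n = 0 then 1
     else 2 * x * hermite (n - 1) x - 2 * real_of_int (n - 1) * hermite (n - 2) x)"
  by pat_completeness auto
termination by (relation "measure (\<lambda>(n, x). nat n)") auto

declare hermite.simps [simp del]

lemma hermite_neg_one [simp]: "hermite (- 1) x = 0"
  by (simp add: hermite.simps)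

lemma hermite_zero [simp]: "hermite 0 x = 1"
  by (simp add: hermite.simps)

lemma hermite_rec:
  "n \<ge> 0 \<Longrightarrow> hermite (n + 1) x = 2 * x * hermite n x - 2 * real_of_int n * hermite (n - 1) x"
  by (subst hermite.simps) simp

function laguerre :: "int \<Rightarrow> real \<Rightarrow> real \<Rightarrow> real" where
  "laguerre n \<alpha> x =
    (if n < 0 then 0
     else if n = 0 then 1
     else ((2 * real_of_int (n - 1) + \<alpha> + 1 - x) * laguerre (n - 1) \<alpha> x
             - (real_of_int (n - 1) + \<alpha>) * laguerre (n - 2) \<alpha> x) / real_of_int n)"
  by pat_completeness auto
termination by (relation "measure (\<lambda>(n, \<alpha>, x). nat n)") auto

declare laguerre.simps [simp del]

lemma laguerre_neg_one [simp]: "laguerre (- 1) \<alpha> x = 0"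
  by (simp add: laguerre.simps)

lemma laguerre_zero [simp]: "laguerre 0 \<alpha> x = 1"
  by (simp add: laguerre.simps)

lemma laguerre_rec:
  "n \<ge> 0 \<Longrightarrow> real_of_int (n + 1) * laguerre (n + 1) \<alpha> x =
    (2 * real_of_int n + \<alpha> + 1 - x) * laguerre n \<alpha> x
      - (real_of_int n + \<alpha>) * laguerre (n - 1) \<alpha> x"
  by (subst laguerre.simps) simp

definition monic_laguerre :: "int \<Rightarrow> real \<Rightarrow> real \<Rightarrow> real" where
  "monic_laguerre n x \<alpha> =
    (if n < 0 then 0 else (- 1) ^ nat n * fact (nat n) * laguerre n \<alpha> x)"

function chebyshev_U :: "int \<Rightarrow> real \<Rightarrow> real" where
  "chebyshev_U n x =
    (if n < 0 then 0
     else if n = 0 then 1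
     else 2 * x * chebyshev_U (n - 1) x - chebyshev_U (n - 2) x)"
  by pat_completeness auto
termination by (relation "measure (\<lambda>(n, x). nat n)") auto

declare chebyshev_U.simps [simp del]

lemma chebyshev_U_neg_one [simp]: "chebyshev_U (- 1) x = 0"
  by (simp add: chebyshev_U.simps)

lemma chebyshev_U_zero [simp]: "chebyshev_U 0 x = 1"
  by (simp add: chebyshev_U.simps)

lemma chebyshev_U_rec:
  "n \<ge> 0 \<Longrightarrow> 2 * x * chebyshev_U n x = chebyshev_U (n + 1) x + chebyshev_U (n - 1) x"
  by (subst (2) chebyshev_U.simps) simp

end

theory Submission
  imports Defs
begin

text \<open>
  Insert the three-term recurrence of each family into \<open>S\<^sub>n = (\<Sum>j. t ^ j / fact j * p\<^sub>n\<^sub>+\<^sub>j)\<close> and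
  absorb every factor \<open>j\<close> by an index shift. For Hermite this gives
  \<open>S\<^sub>n\<^sub>+\<^sub>1 = 2 (x - t) S\<^sub>n - 2 n S\<^sub>n\<^sub>-\<^sub>1\<close>, the recurrence of \<open>H\<^sub>n (x - t)\<close>. For Laguerre it gives
  \<open>(1 + t)\<^sup>2 S\<^sub>n\<^sub>+\<^sub>1 = (x - (2 n + \<alpha> + 1) (1 + t)) S\<^sub>n - n (n + \<alpha>) S\<^sub>n\<^sub>-\<^sub>1\<close>, so that
  \<open>(1 + t) ^ n S\<^sub>n\<close> satisfies the recurrence of \<open>\<lambda>\<^sub>n (x / (1 + t))\<close>. In the Laguerre case the
  intermediate series may diverge at \<open>t\<close> itself; the identity is therefore obtained at \<open>r t\<close> for
  \<open>0 < r < 1\<close> and carried over to \<open>t\<close> by Abel's limit theorem. The Chebyshev identity is the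
  addition formula \<open>U\<^sub>n\<^sub>+\<^sub>j = U\<^sub>n U\<^sub>j - U\<^sub>n\<^sub>-\<^sub>1 U\<^sub>j\<^sub>-\<^sub>1\<close> summed over \<open>j\<close>.
\<close>

section \<open>Index shift in exponentially weighted series\<close>

text \<open>Since \<open>j / fact j = 1 / fact (j - 1)\<close>, a factor \<open>j\<close> costs one
  index shift and one power of \<open>s\<close>; the term at \<open>j = 0\<close> vanishes.\<close>

lemma sums_exp_weight_shift:
  fixes s :: real
  assumes "(\<lambda>j. s ^ j / fact j * f (Suc j)) sums S"
  shows "(\<lambda>j. s ^ j / fact j * (real j * f j)) sums (s * S)"
proof -
  have "(\<lambda>j. s * (s ^ j / fact j * f (Suc j))) sums (s * S)"
    using assms by (rule sums_mult)
  moreover have "s * (s ^ j / fact j * f (Suc j))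
      = s ^ Suc j / fact (Suc j) * (real (Suc j) * f (Suc j))" for j
    by (simp add: field_simps del: of_nat_Suc)
  ultimately have "(\<lambda>j. s ^ Suc j / fact (Suc j) * (real (Suc j) * f (Suc j))) sums (s * S)"
    by simp
  then show ?thesis
    by (subst (asm) sums_Suc_iff) simp
qed

section \<open>Abel's limit theorem\<close>

text \<open>Summation by parts against \<open>R n\<close>, the negative of the tail of the series:
  late values are small, and the factor \<open>1 - r\<close> kills the finitely many early
  ones.\<close>

theorem Abel_limit:
  fixes a :: "nat \<Rightarrow> real"
  assumes "summable a"
  shows "((\<lambda>r. \<Sum>n. a n * r ^ n) \<longlongrightarrow> suminf a) (at_left 1)"
proof -
  define R where "R n = (\<Sum>k<n. a k) - suminf a" for n
  have R0: "R \<longlonglongrightarrow> 0"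
    unfolding R_def using summable_LIMSEQ[OF assms] by (simp add: LIM_zero)
  obtain M where M: "M > 0" "\<And>n. \<bar>R n\<bar> \<le> M"
    using convergent_imp_Bseq[OF convergentI[OF R0]] unfolding Bseq_def by auto
  have RS: "a n = R (Suc n) - R n" for n
    by (simp add: R_def)
  have smR: "summable (\<lambda>n. R n * r ^ n)" "summable (\<lambda>n. R (Suc n) * r ^ n)"
    if "0 < r" "r < 1" for r
  proof -
    have g: "summable (\<lambda>n. M * r ^ n)"
      using that by (intro summable_mult summable_geometric) auto
    show "summable (\<lambda>n. R n * r ^ n)" "summable (\<lambda>n. R (Suc n) * r ^ n)"
      using that M by (auto intro!: summable_comparison_test'[OF g] mult_right_mono
          simp: abs_mult)
  qed
  \<comment> \<open>The constant \<open>suminf a\<close> is absorbed by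
    \<open>R 0 = - suminf a\<close>.\<close>
  have eq: "(\<Sum>n. a n * r ^ n) - suminf a = (1 - r) * (\<Sum>n. R (Suc n) * r ^ n)"
    if "0 < r" "r < 1" for r
  proof -
    note sm = smR[OF that]
    have "(\<Sum>n. a n * r ^ n) = (\<Sum>n. R (Suc n) * r ^ n) - (\<Sum>n. R n * r ^ n)"
      by (subst suminf_diff[OF sm(2,1)]) (simp add: RS algebra_simps)
    moreover have "(\<Sum>n. R n * r ^ n) = R 0 + r * (\<Sum>n. R (Suc n) * r ^ n)"
      using suminf_split_head[OF sm(1)] suminf_mult[OF sm(2), of r]
      by (simp add: algebra_simps)
    ultimately show ?thesis
      by (simp add: R_def algebra_simps)
  qed
  have "((\<lambda>r. (\<Sum>n. a n * r ^ n) - suminf a) \<longlongrightarrow> 0) (at_left 1)"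
  proof (rule tendstoI)
    fix e :: real assume "e > 0"
    then obtain N where N: "\<And>n. n \<ge> N \<Longrightarrow> \<bar>R n\<bar> < e / 2"
      using LIMSEQ_D[OF R0, of "e / 2"] by auto
    have bound: "\<bar>(\<Sum>n. a n * r ^ n) - suminf a\<bar> \<le> e / 2 + (1 - r) * (real N * M)"
      if r: "0 < r" "r < 1" for r
    proof -
      have sE: "(\<lambda>n. e / 2 * r ^ n) sums (e / 2 * (1 / (1 - r)))"
        using r by (intro sums_mult geometric_sums) auto
      have sN: "(\<lambda>n. if n < N then M else 0) sums (real N * M)"
        using sums_If_finite_set[of "{..<N}" "\<lambda>_. M"] by simp
      \<comment> \<open>One majorant for both ranges: \<open>M\<close> for the first
        \<open>N\<close> terms, plus a geometric series whose factor \<open>1 / (1 - r)\<close>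
        later cancels against \<open>1 - r\<close>.\<close>
      have le: "norm (R (Suc n) * r ^ n) \<le> e / 2 * r ^ n + (if n < N then M else 0)" for n
      proof (cases "n < N")
        case True
        have "\<bar>R (Suc n)\<bar> * r ^ n \<le> M * 1"
          using r M by (intro mult_mono) (auto intro: power_le_one)
        then show ?thesis
          using True r \<open>e > 0\<close> by (simp add: abs_mult add_increasing)
      next
        case False
        then show ?thesis
          using r N[of "Suc n"] by (auto simp: abs_mult intro: mult_right_mono)
      qed
      have "norm (\<Sum>n. R (Suc n) * r ^ n) \<le> (\<Sum>n. e / 2 * r ^ n + (if n < N then M else 0))"
        by (rule norm_suminf_le[OF le sums_summable[OF sums_add[OF sE sN]]])
      also have "\<dots> = e / 2 * (1 / (1 - r)) + real N * M"
        using sums_add[OF sE sN] by (rule sums_unique[symmetric])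
      finally have "(1 - r) * \<bar>\<Sum>n. R (Suc n) * r ^ n\<bar>
          \<le> (1 - r) * (e / 2 * (1 / (1 - r)) + real N * M)"
        using r by (intro mult_left_mono) auto
      also have "\<dots> = e / 2 + (1 - r) * (real N * M)"
        using r by (simp add: field_simps)
      finally show ?thesis
        using r by (simp add: eq[OF r] abs_mult)
    qed
    have "((\<lambda>r. e / 2 + (1 - r) * (real N * M)) \<longlongrightarrow> e / 2 + (1 - 1) * (real N * M)) (at_left 1)"
      by (intro tendsto_intros)
    then have "\<forall>\<^sub>F r in at_left 1. e / 2 + (1 - r) * (real N * M) < e"
      by (rule order_tendstoD(2)) (use \<open>e > 0\<close> in simp)
    moreover have "\<forall>\<^sub>F r in at_left (1::real). r \<in> {0<..<1}"
      by (rule eventually_at_left_real) simp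
    ultimately show "\<forall>\<^sub>F r in at_left 1. dist ((\<Sum>n. a n * r ^ n) - suminf a) 0 < e"
    proof eventually_elim
      case (elim r)
      then show ?case
        using bound[of r] by (simp add: dist_real_def)
    qed
  qed
  then show ?thesis
    by (rule LIM_zero_cancel)
qed

section \<open>Hermite polynomials\<close>

text \<open>
  In the recurrences over the naturals the truncated index \<open>n - 1\<close> is harmless at \<open>n = 0\<close>, where
  its coefficient vanishes.
\<close>

lemma hermite_nat_rec:
  "hermite (int (Suc n)) x
    = 2 * x * hermite (int n) x - 2 * real n * hermite (int (n - 1)) x"
  using hermite_rec[of "int n" x] by (cases n) (simp_all add: algebra_simps)

text \<open>The recurrence at \<open>m + j\<close> has the coefficient \<open>2 * (m + j)\<close>:
  the part with \<open>m\<close> gives the series for \<open>m - 1\<close>, the part with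
  \<open>j\<close> gives \<open>t\<close> times the series for \<open>m\<close> and so turns
  \<open>x\<close> into \<open>x - t\<close>.\<close>

lemma hermite_shift_sums:
  assumes "(\<lambda>j. t ^ j / fact j * hermite (int j) x) sums S"
  shows "(\<lambda>j. t ^ j / fact j * hermite (int (n + j)) x) sums (hermite (int n) (x - t) * S)"
proof (induction n rule: less_induct)
  case (less n)
  show ?case
  proof (cases n)
    case 0
    then show ?thesis
      using assms by simp
  next
    case (Suc m)
    have A: "(\<lambda>j. t ^ j / fact j * hermite (int (m + j)) x) sums (hermite (int m) (x - t) * S)"
      using less Suc by simp
    have B: "(\<lambda>j. real m * (t ^ j / fact j * hermite (int (m - 1 + j)) x))
        sums (real m * (hermite (int (m - 1)) (x - t) * S))"
    proof (cases "m = 0")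
      case False
      then show ?thesis
        using Suc by (intro sums_mult less) simp
    qed simp
    have C: "(\<lambda>j. t ^ j / fact j * (real j * hermite (int (m + j - 1)) x))
        sums (t * (hermite (int m) (x - t) * S))"
      using A by (intro sums_exp_weight_shift) simp
    have "(\<lambda>j. 2 * x * (t ^ j / fact j * hermite (int (m + j)) x)
          - 2 * (real m * (t ^ j / fact j * hermite (int (m - 1 + j)) x))
          - 2 * (t ^ j / fact j * (real j * hermite (int (m + j - 1)) x)))
        sums (2 * x * (hermite (int m) (x - t) * S)
          - 2 * (real m * (hermite (int (m - 1)) (x - t) * S))
          - 2 * (t * (hermite (int m) (x - t) * S)))"
      by (intro sums_diff sums_mult[OF A] sums_mult[OF B] sums_mult[OF C])
    also have "2 * x * (hermite (int m) (x - t) * S)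
          - 2 * (real m * (hermite (int (m - 1)) (x - t) * S))
          - 2 * (t * (hermite (int m) (x - t) * S)) = hermite (int n) (x - t) * S"
      unfolding Suc hermite_nat_rec by (simp add: algebra_simps)
    also have "(\<lambda>j. 2 * x * (t ^ j / fact j * hermite (int (m + j)) x)
          - 2 * (real m * (t ^ j / fact j * hermite (int (m - 1 + j)) x))
          - 2 * (t ^ j / fact j * (real j * hermite (int (m + j - 1)) x)))
        = (\<lambda>j. t ^ j / fact j * hermite (int (n + j)) x)"
    proof
      fix j
      define w where "w = t ^ j / fact j"
      \<comment> \<open>At \<open>m = 0\<close> the truncated indices differ for
        \<open>j > 0\<close>, but the factor \<open>real m\<close> makes both sides zero.\<close>
      have m: "real m * (w * hermite (int (m - 1 + j)) x)
          = real m * (w * hermite (int (m + j - 1)) x)"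
        by (cases m) simp_all
      have rec: "hermite (int (n + j)) x = 2 * x * hermite (int (m + j)) x
          - 2 * (real m + real j) * hermite (int (m + j - 1)) x"
        using hermite_nat_rec[of "m + j" x] Suc by simp
      show "2 * x * (t ^ j / fact j * hermite (int (m + j)) x)
          - 2 * (real m * (t ^ j / fact j * hermite (int (m - 1 + j)) x))
          - 2 * (t ^ j / fact j * (real j * hermite (int (m + j - 1)) x))
        = t ^ j / fact j * hermite (int (n + j)) x"
        unfolding w_def[symmetric] m rec by (simp add: algebra_simps)
    qed
    finally show ?thesis .
  qed
qed

section \<open>Monic Laguerre polynomials\<close>

lemma monic_laguerre_zero [simp]: "monic_laguerre 0 x \<alpha> = 1"
  by (simp add: monic_laguerre_def)

lemma monic_laguerre_nat_rec:
  "monic_laguerre (int (Suc n)) x \<alpha>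
    = (x - (2 * real n + \<alpha> + 1)) * monic_laguerre (int n) x \<alpha>
      - real n * (real n + \<alpha>) * monic_laguerre (int (n - 1)) x \<alpha>"
proof -
  have "monic_laguerre (int (Suc n)) x \<alpha>
      = - ((- 1) ^ n * fact n * (real_of_int (int n + 1) * laguerre (int n + 1) \<alpha> x))"
    by (simp add: monic_laguerre_def nat_add_distrib algebra_simps)
  also have "\<dots> = - ((- 1) ^ n * fact n * ((2 * real n + \<alpha> + 1 - x) * laguerre (int n) \<alpha> x
      - (real n + \<alpha>) * laguerre (int n - 1) \<alpha> x))"
    by (subst laguerre_rec) simp_all
  also have "\<dots> = (x - (2 * real n + \<alpha> + 1)) * monic_laguerre (int n) x \<alpha>
      - real n * (real n + \<alpha>) * monic_laguerre (int (n - 1)) x \<alpha>"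
    by (cases n) (simp_all add: monic_laguerre_def nat_add_distrib algebra_simps)
  finally show ?thesis .
qed

text \<open>Serves to let \<open>r\<close> tend to 1 in the argument
  \<open>x / (1 + r * t)\<close>.\<close>

lemma continuous_monic_laguerre:
  "continuous F f \<Longrightarrow> continuous F (\<lambda>y. monic_laguerre (int n) (f y) \<alpha>)"
proof (induction n rule: less_induct)
  case (less n)
  show ?case
  proof (cases n)
    case (Suc m)
    have "continuous F (\<lambda>y. monic_laguerre (int m) (f y) \<alpha>)"
      "continuous F (\<lambda>y. monic_laguerre (int (m - 1)) (f y) \<alpha>)"
      using less Suc by simp_all
    then show ?thesis
      unfolding Suc monic_laguerre_nat_rec using less.prems by (intro continuous_intros)
  qed simp
qed

text \<open>Raising \<open>n\<close> by one differentiates the power series termwise. This keeps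
  convergence inside the interval but may lose it at an endpoint, hence the strict
  inequality.\<close>

lemma summable_laguerre_shift:
  assumes "summable (\<lambda>j. t ^ j / fact j * monic_laguerre (int j) x \<alpha>)" and "\<bar>s\<bar> < \<bar>t\<bar>"
  shows "summable (\<lambda>j. s ^ j / fact j * monic_laguerre (int (n + j)) x \<alpha>)"
  using assms(2)
proof (induction n arbitrary: s)
  case 0
  then show ?case
    using powser_inside[of "\<lambda>j. monic_laguerre (int j) x \<alpha> / fact j" t s] assms(1)
    by (simp add: mult.commute)
next
  case (Suc n)
  have "summable (\<lambda>j. diffs (\<lambda>j. monic_laguerre (int (n + j)) x \<alpha> / fact j) j * s ^ j)"
    using Suc.prems Suc.IH by (intro termdiff_converges[where K = "\<bar>t\<bar>"]) (auto simp: mult.commute)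
  moreover have "diffs (\<lambda>j. monic_laguerre (int (n + j)) x \<alpha> / fact j) j * s ^ j
      = s ^ j / fact j * monic_laguerre (int (Suc n + j)) x \<alpha>" for j
    by (simp add: diffs_def field_simps del: of_nat_Suc of_nat_add)
  ultimately show ?case
    by simp
qed

text \<open>Expand \<open>(n + j) * (n + j + \<alpha>)\<close> as \<open>n * (n + \<alpha>) + (2 * n
  + \<alpha> + 1) * j + j * (j - 1)\<close>; each falling factor then becomes a power of
  \<open>s\<close> by \<open>sums_exp_weight_shift\<close>.\<close>

lemma laguerre_shift_series_rec:
  fixes x s \<alpha> :: real
  defines "F \<equiv> \<lambda>n. \<Sum>j. s ^ j / fact j * monic_laguerre (int (n + j)) x \<alpha>"
  assumes sm: "\<And>n. summable (\<lambda>j. s ^ j / fact j * monic_laguerre (int (n + j)) x \<alpha>)"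
  shows "(1 + s)\<^sup>2 * F (Suc n) = (x - (2 * real n + \<alpha> + 1) * (1 + s)) * F n
    - real n * (real n + \<alpha>) * F (n - 1)"
proof -
  let ?l = "\<lambda>n. monic_laguerre (int n) x \<alpha>"
  have A: "(\<lambda>j. s ^ j / fact j * ?l (k + j)) sums F k" for k
    unfolding F_def by (rule summable_sums[OF sm])
  have B: "(\<lambda>j. s ^ j / fact j * (real j * ?l (n + j - 1))) sums (s * F n)"
    using A[of n] by (intro sums_exp_weight_shift) simp
  have C: "(\<lambda>j. s ^ j / fact j * (real j * ?l (n + j))) sums (s * F (Suc n))"
    using A[of "Suc n"] by (intro sums_exp_weight_shift) simp
  \<comment> \<open>A second shift: replacing \<open>j\<close> by \<open>Suc j\<close> in
    \<open>(real j - 1) * ?l (n + j - 1)\<close> gives the terms of \<open>C\<close>.\<close>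
  have D: "(\<lambda>j. s ^ j / fact j * (real j * ((real j - 1) * ?l (n + j - 1)))) sums (s * (s * F (Suc n)))"
    using C by (intro sums_exp_weight_shift) simp
  have "(\<lambda>j. (x - (2 * real n + \<alpha> + 1)) * (s ^ j / fact j * ?l (n + j))
        - real n * (real n + \<alpha>) * (s ^ j / fact j * ?l (n - 1 + j))
        - (2 * real n + \<alpha> + 1) * (s ^ j / fact j * (real j * ?l (n + j - 1)))
        - 2 * (s ^ j / fact j * (real j * ?l (n + j)))
        - s ^ j / fact j * (real j * ((real j - 1) * ?l (n + j - 1))))
      sums ((x - (2 * real n + \<alpha> + 1)) * F n - real n * (real n + \<alpha>) * F (n - 1)
        - (2 * real n + \<alpha> + 1) * (s * F n) - 2 * (s * F (Suc n)) - s * (s * F (Suc n)))"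
    by (intro sums_diff sums_mult A B C D)
  also have "(\<lambda>j. (x - (2 * real n + \<alpha> + 1)) * (s ^ j / fact j * ?l (n + j))
        - real n * (real n + \<alpha>) * (s ^ j / fact j * ?l (n - 1 + j))
        - (2 * real n + \<alpha> + 1) * (s ^ j / fact j * (real j * ?l (n + j - 1)))
        - 2 * (s ^ j / fact j * (real j * ?l (n + j)))
        - s ^ j / fact j * (real j * ((real j - 1) * ?l (n + j - 1))))
      = (\<lambda>j. s ^ j / fact j * ?l (Suc n + j))"
  proof
    fix j
    define w where "w = s ^ j / fact j"
    have n: "real n * (real n + \<alpha>) * (w * ?l (n - 1 + j))
        = real n * (real n + \<alpha>) * (w * ?l (n + j - 1))"
      by (cases n) simp_all
    have rec: "?l (Suc n + j) = (x - (2 * (real n + real j) + \<alpha> + 1)) * ?l (n + j)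
        - (real n + real j) * (real n + real j + \<alpha>) * ?l (n + j - 1)"
      using monic_laguerre_nat_rec[of "n + j"] by simp
    show "(x - (2 * real n + \<alpha> + 1)) * (s ^ j / fact j * ?l (n + j))
        - real n * (real n + \<alpha>) * (s ^ j / fact j * ?l (n - 1 + j))
        - (2 * real n + \<alpha> + 1) * (s ^ j / fact j * (real j * ?l (n + j - 1)))
        - 2 * (s ^ j / fact j * (real j * ?l (n + j)))
        - s ^ j / fact j * (real j * ((real j - 1) * ?l (n + j - 1)))
      = s ^ j / fact j * ?l (Suc n + j)"
      unfolding w_def[symmetric] n rec by (simp add: algebra_simps)
  qed
  finally have "F (Suc n) = (x - (2 * real n + \<alpha> + 1)) * F n - real n * (real n + \<alpha>) * F (n - 1)
        - (2 * real n + \<alpha> + 1) * (s * F n) - 2 * (s * F (Suc n)) - s * (s * F (Suc n))"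
    using A sums_unique2 by blast
  then show ?thesis
    by (simp add: algebra_simps power2_eq_square)
qed

lemma laguerre_shift_series_interior:
  fixes x s \<alpha> :: real
  defines "F \<equiv> \<lambda>n. \<Sum>j. s ^ j / fact j * monic_laguerre (int (n + j)) x \<alpha>"
  assumes sm: "\<And>n. summable (\<lambda>j. s ^ j / fact j * monic_laguerre (int (n + j)) x \<alpha>)"
    and s: "s \<noteq> - 1"
  shows "(1 + s) ^ n * F n = monic_laguerre (int n) (x / (1 + s)) \<alpha> * F 0"
proof (induction n rule: less_induct)
  case (less n)
  show ?case
  proof (cases n)
    case (Suc m)
    have s1: "1 + s \<noteq> 0"
      using s by linarith
    let ?l = "\<lambda>n. monic_laguerre (int n) (x / (1 + s)) \<alpha>"
    have rec: "(1 + s)\<^sup>2 * F (Suc m) = (x - (2 * real m + \<alpha> + 1) * (1 + s)) * F m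
      - real m * (real m + \<alpha>) * F (m - 1)"
      unfolding F_def by (rule laguerre_shift_series_rec[OF sm])
    have m: "(1 + s) ^ m * F m = ?l m * F 0"
      using less Suc by simp
    \<comment> \<open>One power of \<open>1 + s\<close> is split off to match the induction
      hypothesis at \<open>m - 1\<close>; for \<open>m = 0\<close> both sides vanish.\<close>
    have m1: "real m * ((1 + s) ^ m * F (m - 1)) = (1 + s) * (real m * ?l (m - 1) * F 0)"
      using less[of "m - 1"] Suc by (cases m) (simp_all add: algebra_simps)
    \<comment> \<open>The extra factor \<open>1 + s\<close> completes the square in
      \<open>rec\<close>, as \<open>n = Suc m\<close>; it is cancelled at the end.\<close>
    have "(1 + s) * ((1 + s) ^ n * F n) = (1 + s) ^ m * ((1 + s)\<^sup>2 * F (Suc m))"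
      by (simp add: Suc power2_eq_square)
    also have "\<dots> = (x - (2 * real m + \<alpha> + 1) * (1 + s)) * ((1 + s) ^ m * F m)
        - (real m + \<alpha>) * (real m * ((1 + s) ^ m * F (m - 1)))"
      unfolding rec by (simp add: algebra_simps)
    also have "\<dots> = (x - (2 * real m + \<alpha> + 1) * (1 + s)) * (?l m * F 0)
        - (real m + \<alpha>) * ((1 + s) * (real m * ?l (m - 1) * F 0))"
      unfolding m m1 ..
    also have "x - (2 * real m + \<alpha> + 1) * (1 + s) = (1 + s) * (x / (1 + s) - (2 * real m + \<alpha> + 1))"
      using s1 by (simp add: field_simps)
    also have "(1 + s) * (x / (1 + s) - (2 * real m + \<alpha> + 1)) * (?l m * F 0)
        - (real m + \<alpha>) * ((1 + s) * (real m * ?l (m - 1) * F 0)) = (1 + s) * (?l n * F 0)"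
      unfolding Suc monic_laguerre_nat_rec by (simp add: algebra_simps)
    finally show ?thesis
      using s1 by simp
  qed simp
qed

text \<open>The interior identity holds at \<open>r * t\<close> for \<open>r\<close> close to 1, and
  both sides pass to the limit. The case \<open>t = 0\<close> is separate because
  \<open>\<bar>r * t\<bar> < \<bar>t\<bar>\<close> fails there.\<close>

lemma laguerre_shift_series:
  assumes t: "t \<noteq> - 1"
    and smn: "summable (\<lambda>j. t ^ j / fact j * monic_laguerre (int (n + j)) x \<alpha>)"
    and sm0: "summable (\<lambda>j. t ^ j / fact j * monic_laguerre (int j) x \<alpha>)"
  shows "(\<Sum>j. t ^ j / fact j * monic_laguerre (int (n + j)) x \<alpha>)
    = monic_laguerre (int n) (x / (1 + t)) \<alpha> / (1 + t) ^ n
      * (\<Sum>j. t ^ j / fact j * monic_laguerre (int j) x \<alpha>)"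
proof (cases "t = 0")
  case True
  have "(\<lambda>j. c j * 0 ^ j / fact j) sums c 0" for c :: "nat \<Rightarrow> real"
    using powser_sums_zero[of "\<lambda>j. c j / fact j"] by simp
  then have "(\<Sum>j. 0 ^ j / fact j * c j) = c 0" for c :: "nat \<Rightarrow> real"
    by (simp add: sums_iff mult.commute)
  then show ?thesis
    using True by simp
next
  case False
  let ?F = "\<lambda>n s. \<Sum>j. s ^ j / fact j * monic_laguerre (int (n + j)) x \<alpha>"
  let ?g = "\<lambda>r. monic_laguerre (int n) (x / (1 + r * t)) \<alpha>"
  have lim: "((\<lambda>r. ?F k (r * t)) \<longlongrightarrow> ?F k t) (at_left 1)"
    if "summable (\<lambda>j. t ^ j / fact j * monic_laguerre (int (k + j)) x \<alpha>)" for k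
    using Abel_limit[OF that] by (simp add: power_mult_distrib mult_ac)
  have t1: "1 + t \<noteq> 0"
    using t by linarith
  have "isCont ?g 1"
    using t1 by (intro continuous_monic_laguerre continuous_intros) auto
  then have limg: "(?g \<longlongrightarrow> ?g 1) (at_left 1)"
    unfolding isCont_def by (rule filterlim_mono) (auto intro: at_le)
  have lhs: "((\<lambda>r. (1 + r * t) ^ n * ?F n (r * t)) \<longlongrightarrow> (1 + 1 * t) ^ n * ?F n t) (at_left 1)"
    by (intro tendsto_intros lim smn)
  have rhs: "((\<lambda>r. ?g r * ?F 0 (r * t)) \<longlongrightarrow> ?g 1 * ?F 0 t) (at_left 1)"
    using sm0 by (intro tendsto_mult limg lim) simp
  have "\<forall>\<^sub>F r in at_left 1. ?g r * ?F 0 (r * t) = (1 + r * t) ^ n * ?F n (r * t)"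
  proof -
    \<comment> \<open>For \<open>t < - 1\<close> the value \<open>1 + r * t\<close> vanishes at
      \<open>r = - 1 / t\<close>, so it is nonzero only for \<open>r\<close> close enough to
      1.\<close>
    have "((\<lambda>r. 1 + r * t) \<longlongrightarrow> 1 + 1 * t) (at_left 1)"
      by (intro tendsto_intros)
    then have "\<forall>\<^sub>F r in at_left 1. 1 + r * t \<noteq> 0"
      using t1 by (intro tendsto_imp_eventually_ne) auto
    moreover have "\<forall>\<^sub>F r in at_left (1::real). r \<in> {0<..<1}"
      by (rule eventually_at_left_real) simp
    ultimately show ?thesis
    proof eventually_elim
      case (elim r)
      then have "\<bar>r * t\<bar> < \<bar>t\<bar>"
        using False by (simp add: abs_mult)
      with elim show ?case
        by (intro laguerre_shift_series_interior[symmetric] summable_laguerre_shift[OF sm0]) auto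
    qed
  qed
  with rhs have "((\<lambda>r. (1 + r * t) ^ n * ?F n (r * t)) \<longlongrightarrow> ?g 1 * ?F 0 t) (at_left 1)"
    by (rule Lim_transform_eventually)
  then have "(1 + 1 * t) ^ n * ?F n t = ?g 1 * ?F 0 t"
    by (rule tendsto_unique[OF trivial_limit_at_left_real lhs])
  then have "(1 + t) ^ n * ?F n t = monic_laguerre (int n) (x / (1 + t)) \<alpha> * ?F 0 t"
    by simp
  then show ?thesis
    using t1 by (simp add: nonzero_eq_divide_eq mult.commute)
qed

section \<open>Chebyshev polynomials of the second kind\<close>

text \<open>Read \<open>Suc n + j\<close> as \<open>n + Suc j\<close> and apply the recurrence in
  both \<open>j\<close> and \<open>n\<close>. Integer indices let \<open>n = 0\<close> and
  \<open>j = 0\<close> use the value 0 at index -1.\<close>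

lemma chebyshev_U_add:
  "chebyshev_U (int (n + j)) x
    = chebyshev_U (int n) x * chebyshev_U (int j) x
      - chebyshev_U (int n - 1) x * chebyshev_U (int j - 1) x"
proof (induction n arbitrary: j)
  case (Suc n)
  have "chebyshev_U (int (Suc n + j)) x = chebyshev_U (int n) x * chebyshev_U (int j + 1) x
      - chebyshev_U (int n - 1) x * chebyshev_U (int j) x"
    using Suc.IH[of "Suc j"] by (simp add: add.commute)
  moreover have "chebyshev_U (int j + 1) x = 2 * x * chebyshev_U (int j) x - chebyshev_U (int j - 1) x"
    using chebyshev_U_rec[of "int j" x] by simp
  moreover have "chebyshev_U (int (Suc n)) x = 2 * x * chebyshev_U (int n) x - chebyshev_U (int n - 1) x"
    using chebyshev_U_rec[of "int n" x] by (simp add: add.commute)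
  moreover have "chebyshev_U (int (Suc n) - 1) x = chebyshev_U (int n) x"
    by simp
  ultimately show ?case
    by algebra
qed simp

lemma chebyshev_U_shift_sums:
  assumes "(\<lambda>j. t ^ j * chebyshev_U (int j) x) sums S"
  shows "(\<lambda>j. t ^ j * chebyshev_U (int (n + j)) x)
    sums ((chebyshev_U (int n) x - t * chebyshev_U (int n - 1) x) * S)"
proof -
  \<comment> \<open>Prepending the term at index -1, which is 0, makes this shift cost only the
    factor \<open>t\<close>.\<close>
  have "(\<lambda>j. t ^ Suc j * chebyshev_U (int (Suc j) - 1) x) sums (t * S)"
    using sums_mult[OF assms, of t] by (simp add: mult.assoc)
  then have "(\<lambda>j. t ^ j * chebyshev_U (int j - 1) x) sums (t * S)"
    by (subst (asm) sums_Suc_iff) simp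
  then have "(\<lambda>j. chebyshev_U (int n) x * (t ^ j * chebyshev_U (int j) x)
      - chebyshev_U (int n - 1) x * (t ^ j * chebyshev_U (int j - 1) x))
      sums (chebyshev_U (int n) x * S - chebyshev_U (int n - 1) x * (t * S))"
    by (intro sums_diff sums_mult assms)
  then show ?thesis
    unfolding chebyshev_U_add by (simp add: algebra_simps)
qed

theorem lemma2:
  fixes n :: nat and x t \<alpha> :: real
  shows
    "(summable (\<lambda>j. t ^ j / fact j * hermite (int (n + j)) x) \<longrightarrow>
      summable (\<lambda>j. t ^ j / fact j * hermite (int j) x) \<longrightarrow>
      (\<Sum>j. t ^ j / fact j * hermite (int (n + j)) x) =
        hermite (int n) (x - t) * (\<Sum>j. t ^ j / fact j * hermite (int j) x))
   \<and> (t \<noteq> - 1 \<longrightarrow>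
      summable (\<lambda>j. t ^ j / fact j * monic_laguerre (int (n + j)) x \<alpha>) \<longrightarrow>
      summable (\<lambda>j. t ^ j / fact j * monic_laguerre (int j) x \<alpha>) \<longrightarrow>
      (\<Sum>j. t ^ j / fact j * monic_laguerre (int (n + j)) x \<alpha>) =
        monic_laguerre (int n) (x / (1 + t)) \<alpha> / (1 + t) ^ n *
          (\<Sum>j. t ^ j / fact j * monic_laguerre (int j) x \<alpha>))
   \<and> (summable (\<lambda>j. t ^ j * chebyshev_U (int (n + j)) x) \<longrightarrow>
      summable (\<lambda>j. t ^ j * chebyshev_U (int j) x) \<longrightarrow>
      (\<Sum>j. t ^ j * chebyshev_U (int (n + j)) x) =
        (chebyshev_U (int n) x - t * chebyshev_U (int n - 1) x) *
          (\<Sum>j. t ^ j * chebyshev_U (int j) x))"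
  using hermite_shift_sums[OF summable_sums, THEN sums_unique, symmetric, of t x n]
    laguerre_shift_series[of t n x \<alpha>]
    chebyshev_U_shift_sums[OF summable_sums, THEN sums_unique, symmetric, of t x n]
  by blast

end
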